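(* Let $(\mathcal{L},\models,\mathfrak{M})$ be a satisfaction system with finite $\mathcal{L}$ and let $\Phi_1,\ldots,\Phi_n\subseteq\mathcal{L}$ be non-trivial sets of statements. Consider the following procedure: if $\bigcup_{i=1}^n\Phi_i$ is consistent, output $\{\bigcup_{i=1}^n\Phi_i\}$; otherwise let $\Psi_1=\{\varphi\in\mathcal{L}\mid \varphi\text{ non-trivial}\}$, $\Psi_3=\{\varphi\in\mathcal{L}\mid \{\varphi,\varphi'\}\text{ is consistent for all }\varphi'\in\bigcup_{i=1}^n\Phi_i\}$, $\Psi_4=\{\varphi\in\mathcal{L}\mid \Phi_i\models\varphi\text{ for some }i\in\{1,\ldots,n\}\}$, and output the (possibly empty) set of all cardinality-maximal consistent subsets of $\Psi_1\cap\Psi_3\cap\Psi_4$. Then the output is the set of all middle grounds for $\Phi_1,\ldots,\Phi_n$ up to logical equivalence: every set in the output is a middle ground for $\Phi_1,\ldots,\Phi_n$, and every middle ground for $\Phi_1,\ldots,\Phi_n$ is logically equivalent to some set in the output.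
   Context: A satisfaction system is a triple $(\mathcal{L},\models,\mathfrak{M})$ where $\mathcal{L}$ is a language (a set of statements), $\mathfrak{M}$ a set of models and $\models\subseteq\mathfrak{M}\times\mathcal{L}$ a satisfaction relation. For $\Phi\subseteq\mathcal{L}$, $\pi\models\Phi$ iff $\pi\models\phi$ for all $\phi\in\Phi$; $\mathsf{mod}(\Phi)$ is the set of models $\pi\in\mathfrak{M}$ with $\pi\models\Phi$; $\Phi\models\Phi'$ iff every $\pi\in\mathfrak{M}$ with $\pi\models\Phi$ satisfies $\pi\models\Phi'$; $\Phi\equiv\Phi'$ iff $\Phi\models\Phi'$ and $\Phi'\models\Phi$. A statement $\phi$ is identified with $\{\phi\}$. $\Phi$ is consistent if $\mathsf{mod}(\Phi)\neq\emptyset$, falsifiable if $\mathsf{mod}(\Phi)\neq\mathfrak{M}$, and non-trivial if it is consistent and falsifiable. Given non-trivial sets $\Phi_1,\ldots,\Phi_n\subseteq\mathcal{L}$, a set $\Phi\subseteq\mathcal{L}$ is a middle ground for $\Phi_1,\ldots,\Phi_n$ if: (P1) $\Phi$ is non-trivial; (P2) if $\bigcup_{i=1}^n\Phi_i$ is consistent then $\Phi\equiv\bigcup_{i=1}^n\Phi_i$; (P3) for each $\phi\in\Phi$, all $i\in\{1,\ldots,n\}$ and all $\phi_i\in\Phi_i$ there is $\pi\in\mathfrak{M}$ with $\pi\models\phi$ and $\pi\models\phi_i$; (P4) for each $\phi\in\Phi$ there is $i$ with $\Phi_i\models\phi$; (P5) there is no $\Phi'\subseteq\mathcal{L}$ with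 $\Phi'\models\Phi$, $\Phi\not\models\Phi'$ and $\Phi'$ satisfying (P1)–(P4).
   Formalization: "Cardinality-maximal" is replaced by inclusion-maximal, since middle grounds that are not of largest cardinality would otherwise be missed, and the empty set is excluded from the output in the inconsistent case, since it is not falsifiable; n ≥ 1 is assumed. *)

theory Defs
  imports Main
begin

record ('s, 'm) satsys =
  lang :: "'s set"
  sat :: "('m \<times> 's) set"
  models :: "'m set"

definition satisfaction_system :: "('s, 'm) satsys \<Rightarrow> bool" where
  "satisfaction_system S \<longleftrightarrow> sat S \<subseteq> models S \<times> lang S"

definition satisfies :: "('s, 'm) satsys \<Rightarrow> 'm \<Rightarrow> 's set \<Rightarrow> bool" where
  "satisfies S \<pi> \<Phi> \<longleftrightarrow> (\<forall>\<phi>\<in>\<Phi>. (\<pi>, \<phi>) \<in> sat S)"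

definition mods :: "('s, 'm) satsys \<Rightarrow> 's set \<Rightarrow> 'm set" where
  "mods S \<Phi> = {\<pi> \<in> models S. satisfies S \<pi> \<Phi>}"

definition entails :: "('s, 'm) satsys \<Rightarrow> 's set \<Rightarrow> 's set \<Rightarrow> bool" where
  "entails S \<Phi> \<Phi>' \<longleftrightarrow> (\<forall>\<pi>\<in>models S. satisfies S \<pi> \<Phi> \<longrightarrow> satisfies S \<pi> \<Phi>')"

definition logically_equiv :: "('s, 'm) satsys \<Rightarrow> 's set \<Rightarrow> 's set \<Rightarrow> bool" where
  "logically_equiv S \<Phi> \<Phi>' \<longleftrightarrow> entails S \<Phi> \<Phi>' \<and> entails S \<Phi>' \<Phi>"

definition consistent :: "('s, 'm) satsys \<Rightarrow> 's set \<Rightarrow> bool" where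
  "consistent S \<Phi> \<longleftrightarrow> mods S \<Phi> \<noteq> {}"

definition falsifiable :: "('s, 'm) satsys \<Rightarrow> 's set \<Rightarrow> bool" where
  "falsifiable S \<Phi> \<longleftrightarrow> mods S \<Phi> \<noteq> models S"

definition non_trivial :: "('s, 'm) satsys \<Rightarrow> 's set \<Rightarrow> bool" where
  "non_trivial S \<Phi> \<longleftrightarrow> consistent S \<Phi> \<and> falsifiable S \<Phi>"

text \<open>Throughout, a finite family of sets of statements is given by its length \<open>n\<close> and a
  function on \<open>nat\<close>, of which only the values on \<open>{1..n}\<close> matter.\<close>

definition P1 :: "('s, 'm) satsys \<Rightarrow> 's set \<Rightarrow> bool" where
  "P1 S \<Phi> \<longleftrightarrow> non_trivial S \<Phi>"

definition P2 :: "('s, 'm) satsys \<Rightarrow> nat \<Rightarrow> (nat \<Rightarrow> 's set) \<Rightarrow> 's set \<Rightarrow> bool" where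
  "P2 S n \<Phi>s \<Phi> \<longleftrightarrow>
    (consistent S (\<Union>i\<in>{1..n}. \<Phi>s i) \<longrightarrow> logically_equiv S \<Phi> (\<Union>i\<in>{1..n}. \<Phi>s i))"

definition P3 :: "('s, 'm) satsys \<Rightarrow> nat \<Rightarrow> (nat \<Rightarrow> 's set) \<Rightarrow> 's set \<Rightarrow> bool" where
  "P3 S n \<Phi>s \<Phi> \<longleftrightarrow>
    (\<forall>\<phi>\<in>\<Phi>. \<forall>i\<in>{1..n}. \<forall>\<psi>\<in>\<Phi>s i. \<exists>\<pi>\<in>models S. satisfies S \<pi> {\<phi>} \<and> satisfies S \<pi> {\<psi>})"

definition P4 :: "('s, 'm) satsys \<Rightarrow> nat \<Rightarrow> (nat \<Rightarrow> 's set) \<Rightarrow> 's set \<Rightarrow> bool" where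
  "P4 S n \<Phi>s \<Phi> \<longleftrightarrow> (\<forall>\<phi>\<in>\<Phi>. \<exists>i\<in>{1..n}. entails S (\<Phi>s i) {\<phi>})"

definition P1_to_P4 :: "('s, 'm) satsys \<Rightarrow> nat \<Rightarrow> (nat \<Rightarrow> 's set) \<Rightarrow> 's set \<Rightarrow> bool" where
  "P1_to_P4 S n \<Phi>s \<Phi> \<longleftrightarrow> P1 S \<Phi> \<and> P2 S n \<Phi>s \<Phi> \<and> P3 S n \<Phi>s \<Phi> \<and> P4 S n \<Phi>s \<Phi>"

definition P5 :: "('s, 'm) satsys \<Rightarrow> nat \<Rightarrow> (nat \<Rightarrow> 's set) \<Rightarrow> 's set \<Rightarrow> bool" where
  "P5 S n \<Phi>s \<Phi> \<longleftrightarrow>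
    \<not> (\<exists>\<Phi>'\<subseteq>lang S. entails S \<Phi>' \<Phi> \<and> \<not> entails S \<Phi> \<Phi>' \<and> P1_to_P4 S n \<Phi>s \<Phi>')"

definition middle_ground :: "('s, 'm) satsys \<Rightarrow> nat \<Rightarrow> (nat \<Rightarrow> 's set) \<Rightarrow> 's set \<Rightarrow> bool" where
  "middle_ground S n \<Phi>s \<Phi> \<longleftrightarrow> \<Phi> \<subseteq> lang S \<and> P1_to_P4 S n \<Phi>s \<Phi> \<and> P5 S n \<Phi>s \<Phi>"

definition Psi1 :: "('s, 'm) satsys \<Rightarrow> 's set" where
  "Psi1 S = {\<phi> \<in> lang S. non_trivial S {\<phi>}}"

definition Psi3 :: "('s, 'm) satsys \<Rightarrow> nat \<Rightarrow> (nat \<Rightarrow> 's set) \<Rightarrow> 's set" where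
  "Psi3 S n \<Phi>s = {\<phi> \<in> lang S. \<forall>\<psi>\<in>(\<Union>i\<in>{1..n}. \<Phi>s i). consistent S {\<phi>, \<psi>}}"

definition Psi4 :: "('s, 'm) satsys \<Rightarrow> nat \<Rightarrow> (nat \<Rightarrow> 's set) \<Rightarrow> 's set" where
  "Psi4 S n \<Phi>s = {\<phi> \<in> lang S. \<exists>i\<in>{1..n}. entails S (\<Phi>s i) {\<phi>}}"

text \<open>Maximality means that the set cannot be enlarged within \<open>\<Psi>\<close> without losing consistency;
  it does not mean having the largest number of elements among all consistent subsets of \<open>\<Psi>\<close>.
  With the latter notion the procedure misses middle grounds: take \<open>\<Phi>\<^sub>1 = {p}\<close>,
  \<open>\<Phi>\<^sub>2 = {q}\<close>, \<open>\<Phi>\<^sub>3 = {t}\<close> in the language \<open>{p, q, t, r, r', s, u}\<close> with six models satisfying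
  exactly \<open>{p, r, r', s}\<close>, \<open>{p, r, r', u}\<close>, \<open>{q, s, r, r'}\<close>, \<open>{q, s, u}\<close>, \<open>{t, u, r, r'}\<close> and
  \<open>{t, u, s}\<close>. Then \<open>\<Psi> = {r, r', s, u}\<close>, and \<open>{s, u}\<close> is a middle ground that is not equivalent
  to \<open>{r, r', s}\<close> or \<open>{r, r', u}\<close>.

  The empty set is excluded because it is not falsifiable; thus there is no maximal consistent
  subset of \<open>\<Psi> = {}\<close>.\<close>

definition maximal_consistent_subset :: "('s, 'm) satsys \<Rightarrow> 's set \<Rightarrow> 's set \<Rightarrow> bool" where
  "maximal_consistent_subset S \<Psi> X \<longleftrightarrow>
    X \<noteq> {} \<and> X \<subseteq> \<Psi> \<and> consistent S X \<and> \<not> (\<exists>Y. X \<subset> Y \<and> Y \<subseteq> \<Psi> \<and> consistent S Y)"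

definition middle_ground_procedure :: "('s, 'm) satsys \<Rightarrow> nat \<Rightarrow> (nat \<Rightarrow> 's set) \<Rightarrow> 's set set" where
  "middle_ground_procedure S n \<Phi>s =
    (if consistent S (\<Union>i\<in>{1..n}. \<Phi>s i) then {\<Union>i\<in>{1..n}. \<Phi>s i}
     else {X. maximal_consistent_subset S (Psi1 S \<inter> Psi3 S n \<Phi>s \<inter> Psi4 S n \<Phi>s) X})"

end

theory Submission
  imports Defs
begin

text \<open>Let \<open>K = \<Psi>\<^sub>1 \<inter> \<Psi>\<^sub>3 \<inter> \<Psi>\<^sub>4\<close> and suppose that the union of the given sets is inconsistent,
  so that P2 is vacuous. Every nonempty consistent subset of \<open>K\<close> satisfies P1--P4. Conversely, the
  unfalsifiable members of a set satisfying P1--P4 are tautologies; dropping them leaves an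
  equivalent nonempty consistent subset of \<open>K\<close>. So, up to equivalence, P5 asks for a subset of
  \<open>K\<close> that is minimal for entailment among the consistent ones, and these are given by the subsets
  that are maximal for inclusion.\<close>

lemma consistent_iff: "consistent S X \<longleftrightarrow> (\<exists>\<pi>\<in>models S. satisfies S \<pi> X)"
  by (auto simp: consistent_def mods_def)

lemma falsifiable_iff: "falsifiable S X \<longleftrightarrow> (\<exists>\<pi>\<in>models S. \<not> satisfies S \<pi> X)"
  by (auto simp: falsifiable_def mods_def)

lemma entails_refl: "entails S X X"
  by (simp add: entails_def)

lemma entails_subset: "Y \<subseteq> X \<Longrightarrow> entails S X Y"
  by (auto simp: entails_def satisfies_def)

lemma entails_trans: "entails S X Y \<Longrightarrow> entails S Y Z \<Longrightarrow> entails S X Z"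
  by (simp add: entails_def)

lemma falsifiable_mono: "falsifiable S X \<Longrightarrow> X \<subseteq> Y \<Longrightarrow> falsifiable S Y"
  by (auto simp: falsifiable_iff satisfies_def)

abbreviation candidates :: "('s, 'm) satsys \<Rightarrow> nat \<Rightarrow> (nat \<Rightarrow> 's set) \<Rightarrow> 's set" where
  "candidates S n \<Phi>s \<equiv> Psi1 S \<inter> Psi3 S n \<Phi>s \<inter> Psi4 S n \<Phi>s"

text \<open>P5 holds because P2 already forces every competitor to be equivalent to the union. For
  P3, one model of the union satisfies any two statements occurring in it.\<close>

lemma Un_middle_ground:
  assumes "n \<ge> 1"
    and "\<And>i. i \<in> {1..n} \<Longrightarrow> \<Phi>s i \<subseteq> lang S"
    and "\<And>i. i \<in> {1..n} \<Longrightarrow> non_trivial S (\<Phi>s i)"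
    and "consistent S (\<Union>i\<in>{1..n}. \<Phi>s i)" (is "consistent S ?U")
  shows "middle_ground S n \<Phi>s ?U"
proof -
  have one: "1 \<in> {1..n}" using assms(1) by simp
  have "falsifiable S (\<Phi>s 1)" using assms(3)[OF one] by (simp add: non_trivial_def)
  then have "falsifiable S ?U" by (rule falsifiable_mono) (use one in blast)
  then have "P1 S ?U" using assms(4) by (simp add: P1_def non_trivial_def)
  moreover have "P2 S n \<Phi>s ?U" by (simp add: P2_def logically_equiv_def entails_refl)
  moreover have "P3 S n \<Phi>s ?U"
    using assms(4) unfolding P3_def consistent_iff satisfies_def by blast
  moreover have "P4 S n \<Phi>s ?U" by (auto simp: P4_def entails_def satisfies_def)
  moreover have "P5 S n \<Phi>s ?U"
    using assms(4) by (auto simp: P5_def P1_to_P4_def P2_def logically_equiv_def)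
  moreover have "?U \<subseteq> lang S" using assms(2) by blast
  ultimately show ?thesis by (simp add: middle_ground_def P1_to_P4_def)
qed

lemma P1_to_P4_if_subset_candidates:
  assumes "\<not> consistent S (\<Union>i\<in>{1..n}. \<Phi>s i)"
    and "X \<noteq> {}" "X \<subseteq> candidates S n \<Phi>s" "consistent S X"
  shows "P1_to_P4 S n \<Phi>s X"
proof -
  \<comment> \<open>Nonemptiness enters here: a model falsifying a single member of \<open>X\<close>
    falsifies \<open>X\<close>.\<close>
  obtain \<phi> where "\<phi> \<in> X" "falsifiable S {\<phi>}"
    using assms(2,3) by (auto simp: Psi1_def non_trivial_def)
  then have "falsifiable S X" using falsifiable_mono[of S "{\<phi>}" X] by simp
  then have "P1 S X" using assms(4) by (simp add: P1_def non_trivial_def)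
  moreover have "P2 S n \<Phi>s X" using assms(1) by (simp add: P2_def)
  moreover have "P3 S n \<Phi>s X"
    using assms(3) unfolding P3_def Psi3_def consistent_iff satisfies_def by blast
  moreover have "P4 S n \<Phi>s X" using assms(3) by (auto simp: P4_def Psi4_def)
  ultimately show ?thesis by (simp add: P1_to_P4_def)
qed

text \<open>P3 and P4 constrain each statement separately, so they yield membership in
  \<open>Psi3\<close> and \<open>Psi4\<close> one element at a time.\<close>

lemma Int_Psi1_subset_candidates:
  assumes "P1_to_P4 S n \<Phi>s X"
  shows "X \<inter> Psi1 S \<subseteq> candidates S n \<Phi>s"
proof
  fix \<phi> assume \<phi>: "\<phi> \<in> X \<inter> Psi1 S"
  then have "\<phi> \<in> Psi3 S n \<Phi>s"
    using assms unfolding P1_to_P4_def P3_def Psi3_def Psi1_def consistent_iff satisfies_def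
    by blast
  moreover have "\<phi> \<in> Psi4 S n \<Phi>s"
    using assms \<phi> by (auto simp: P1_to_P4_def P4_def Psi4_def Psi1_def)
  ultimately show "\<phi> \<in> candidates S n \<Phi>s" using \<phi> by blast
qed

text \<open>Each member of a consistent set is consistent, so one outside \<open>Psi1\<close> can
  only fail to be falsifiable; it then holds in every model.\<close>

lemma entails_Int_Psi1:
  assumes "X \<subseteq> lang S" "consistent S X"
  shows "entails S (X \<inter> Psi1 S) X"
  using assms
  unfolding entails_def satisfies_def Psi1_def non_trivial_def consistent_iff falsifiable_iff
  by blast

text \<open>Otherwise all members of \<open>X\<close> would be tautologies, against
  falsifiability.\<close>

lemma Int_Psi1_nonempty:
  assumes "X \<subseteq> lang S" "non_trivial S X"
  shows "X \<inter> Psi1 S \<noteq> {}"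
proof
  assume "X \<inter> Psi1 S = {}"
  then have "entails S {} X" using entails_Int_Psi1[of X S] assms by (simp add: non_trivial_def)
  then show False
    using assms(2) by (auto simp: entails_def non_trivial_def falsifiable_iff satisfies_def)
qed

lemma maximal_middle_ground:
  assumes "\<not> consistent S (\<Union>i\<in>{1..n}. \<Phi>s i)"
    and max: "maximal_consistent_subset S (candidates S n \<Phi>s) X"
  shows "middle_ground S n \<Phi>s X"
proof -
  have X: "X \<noteq> {}" "X \<subseteq> candidates S n \<Phi>s" "consistent S X"
    using max by (simp_all add: maximal_consistent_subset_def)
  have "entails S X Y"
    if Y: "Y \<subseteq> lang S" "entails S Y X" "P1_to_P4 S n \<Phi>s Y" for Y
  proof -
    have cY: "consistent S Y" using Y(3) by (simp add: P1_to_P4_def P1_def non_trivial_def)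
    \<comment> \<open>Any model of \<open>Y\<close> is a model of \<open>X\<close> as well, so the
      non-trivial part of a competitor can be added to \<open>X\<close>; maximality then shows that
      it was already contained in \<open>X\<close>.\<close>
    then have "consistent S (X \<union> (Y \<inter> Psi1 S))"
      using Y(2) unfolding consistent_iff entails_def satisfies_def by blast
    moreover have "X \<union> (Y \<inter> Psi1 S) \<subseteq> candidates S n \<Phi>s"
      using X(2) Int_Psi1_subset_candidates[OF Y(3)] by simp
    ultimately have "\<not> X \<subset> X \<union> (Y \<inter> Psi1 S)"
      using max by (metis maximal_consistent_subset_def)
    then have "Y \<inter> Psi1 S \<subseteq> X" by blast
    from entails_trans[OF entails_subset[OF this] entails_Int_Psi1[OF Y(1) cY]]
    show ?thesis .
  qed
  then have "P5 S n \<Phi>s X" unfolding P5_def by blast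
  moreover have "X \<subseteq> lang S" using X(2) by (auto simp: Psi1_def)
  ultimately show ?thesis
    using P1_to_P4_if_subset_candidates[OF assms(1) X] by (simp add: middle_ground_def)
qed

text \<open>A finite \<open>K\<close> has finitely many consistent subsets, so one that is maximal
  for inclusion lies above \<open>Z\<close>; it inherits nonemptiness from \<open>Z\<close>.\<close>

lemma extend_to_maximal_consistent_subset:
  assumes "finite K" "Z \<noteq> {}" "Z \<subseteq> K" "consistent S Z"
  obtains X where "maximal_consistent_subset S K X" "Z \<subseteq> X"
proof -
  obtain X where "X \<subseteq> K \<and> consistent S X" "Z \<subseteq> X"
    and "\<And>Y. Y \<subseteq> K \<and> consistent S Y \<Longrightarrow> X \<subseteq> Y \<Longrightarrow> X = Y"
    using finite_has_maximal2[of "{Y. Y \<subseteq> K \<and> consistent S Y}" Z] assms by auto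
  then show thesis
    using that[of X] assms(2) unfolding maximal_consistent_subset_def by blast
qed

lemma middle_ground_equiv_maximal:
  assumes "finite (lang S)" "\<not> consistent S (\<Union>i\<in>{1..n}. \<Phi>s i)" "middle_ground S n \<Phi>s \<Phi>"
  obtains X where "maximal_consistent_subset S (candidates S n \<Phi>s) X" "logically_equiv S \<Phi> X"
proof -
  have \<Phi>: "\<Phi> \<subseteq> lang S" "P1_to_P4 S n \<Phi>s \<Phi>" "P5 S n \<Phi>s \<Phi>"
    using assms(3) by (simp_all add: middle_ground_def)
  have nt: "non_trivial S \<Phi>" using \<Phi>(2) by (simp add: P1_to_P4_def P1_def)
  have "finite (candidates S n \<Phi>s)"
    using assms(1) by (rule rev_finite_subset) (auto simp: Psi1_def)
  moreover have "consistent S (\<Phi> \<inter> Psi1 S)"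
    using nt by (auto simp: non_trivial_def consistent_iff satisfies_def)
  ultimately obtain X where max: "maximal_consistent_subset S (candidates S n \<Phi>s) X"
      and sub: "\<Phi> \<inter> Psi1 S \<subseteq> X"
    using extend_to_maximal_consistent_subset[OF _ Int_Psi1_nonempty[OF \<Phi>(1) nt]
        Int_Psi1_subset_candidates[OF \<Phi>(2)]]
    by metis
  \<comment> \<open>\<open>X\<close> contains the non-trivial part of \<open>\<Phi>\<close>, which
    entails all of \<open>\<Phi>\<close>. Since \<open>X\<close> also satisfies P1--P4, it would
    violate P5 for \<open>\<Phi>\<close> unless \<open>\<Phi>\<close> entails
    \<open>X\<close>.\<close>
  have "entails S X \<Phi>"
    using entails_trans[OF entails_subset[OF sub] entails_Int_Psi1[OF \<Phi>(1)]] nt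
    by (simp add: non_trivial_def)
  moreover have "X \<subseteq> lang S" "P1_to_P4 S n \<Phi>s X"
    using maximal_middle_ground[OF assms(2) max] by (simp_all add: middle_ground_def)
  ultimately have "logically_equiv S \<Phi> X"
    using \<Phi>(3) by (auto simp: P5_def logically_equiv_def)
  with max show thesis by (rule that)
qed

theorem theorem5:
  fixes S :: "('s, 'm) satsys" and n :: nat and \<Phi>s :: "nat \<Rightarrow> 's set"
  assumes "satisfaction_system S"
    and "finite (lang S)"
    and "n \<ge> 1"
    and "\<And>i. i \<in> {1..n} \<Longrightarrow> \<Phi>s i \<subseteq> lang S"
    and "\<And>i. i \<in> {1..n} \<Longrightarrow> non_trivial S (\<Phi>s i)"
  shows "(\<forall>X\<in>middle_ground_procedure S n \<Phi>s. middle_ground S n \<Phi>s X) \<and>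
    (\<forall>\<Phi>. middle_ground S n \<Phi>s \<Phi> \<longrightarrow>
      (\<exists>X\<in>middle_ground_procedure S n \<Phi>s. logically_equiv S \<Phi> X))"
proof (cases "consistent S (\<Union>i\<in>{1..n}. \<Phi>s i)")
  case True
  \<comment> \<open>The output has a single element, and P2 makes every middle ground equivalent to
    it.\<close>
  then show ?thesis
    using Un_middle_ground[OF assms(3-5) True]
    by (auto simp: middle_ground_procedure_def middle_ground_def P1_to_P4_def P2_def)
next
  case False
  then have "middle_ground_procedure S n \<Phi>s =
      {X. maximal_consistent_subset S (candidates S n \<Phi>s) X}"
    by (simp add: middle_ground_procedure_def)
  then show ?thesis
    using maximal_middle_ground[OF False] middle_ground_equiv_maximal[OF assms(2) False]
    by blast
qed

end
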